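(* Let $\mathcal N$ be a 1-input regular coupled cell network with $n$ cells and an $m$-cell ring, with $1\le m\le n$. Given a balanced colouring of the cells of $\mathcal N$ associated to a join-irreducible synchrony subspace for $\mathcal N$, we have one of the following: (i) all the cells have the same colour; (ii) the cells in the ring are coloured with a sequence of $\frac md$ different colours, with $d$ a proper divisor of $m$ different from $1$, that is repeated sequentially $d$ times, and if we wrap each of the rooted trees over the ring then overlapping cells have the same colour; (iii) the cells in the ring have different colours, and if we wrap each of the rooted trees over the ring then overlapping cells have the same colour; (iv) all the cells with the exception of a nonempty subset of leaves have the same colour, and the cells in that subset of leaves have another different colour; (v) all the cells with the exception of those in a nonempty subset $J$ of subtrees, with $s=\max\{\mathrm{depth}(\mathcal B):\mathcal B\in J\}>1$, have the same colour $r$. For each subtree $\mathcal B_i\in J$, cells at different distances from the root cell of the subtree have different colours and cells at the same distance have the same colour. Moreover, given any two subtrees, if a cell in one of the subtrees is at the same distance from the root cell of its subtree as a cell in the other subtree is from the corresponding root cell, then the two cells have the same colour.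
   Context: A 1-input regular coupled cell network is a finite connected directed graph (self-loops allowed) in which all cells (vertices) are of one type, all edges are of one type, and every cell receives exactly one edge. A directed rooted tree is a network with a cell (the root) from which there is exactly one directed path to every other cell; its leaves are the cells with no outgoing edge. A subtree of a tree is a connected subgraph of the tree; it is regarded as a directed rooted tree, with its own root cell. The depth of a directed rooted tree is the maximum, over its leaves, of the number of edges in the directed path from the root to the leaf (zero if there are no leaves). The distance from a root cell to a cell is the number of edges of the directed path from the former to the latter. A 1-input regular coupled cell network is either a ring (a directed cycle, in particular possibly a self-loop) or the coalescence of a ring with the disjoint union of finitely many directed rooted trees, the root of each tree being merged with a different cell of the ring; these are the rooted trees in the claim, and the subtrees and leaves in the claim are those of these trees. Wrapping a rooted tree over the ring means: a cell of the tree at distance $k$ from the root $\rho$ (a ring cell) is laid over the ring cell reached from $\rho$ by following $k$ edges of the ring; cells placed at the same position overlap. Each cell phase space is taken to be $\mathbb R$, so the total phase space is $\mathbb R^n$. A synchrony subspace of $\mathcal N$ is a subspace $\Delta_{\bowtie}=\{x\in\mathbb R^n:\ x_c=x_d\text{ whenever }c\bowtie d\}$, for an equivalence relation $\bowtie$ on the cells, that is flow-invariant under all vector fields $\dot x_c=f(x_c;x_{i(c)})$ with $f$ smooth and $i(c)$ the tail cell of the unique edge into $c$. Equivalently, $\bowtie$ is balanced: colouring the cells by $\bowtie$-class, cells with the same colour receive their input edge from cells of a same colour. This colouring is the balanced colouring associated to $\Delta_{\bowtie}$. The synchrony subspaces of $\mathcal N$ form a lattice under inclusion, with join given by the sum of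 subspaces; the join-irreducible ones are the synchrony subspaces that are not the join (sum) of any other two synchrony subspaces in the lattice. *)

theory Defs
  imports "HOL-Analysis.Analysis"
begin

text \<open>
  A network is given by its edge relation on a finite type of cells; a pair (b, c) is an edge with
  tail b and head c, so it is an edge received by c. As every cell receives exactly one edge, there
  are no parallel edges and a relation loses no information. Connectedness is that of the underlying
  undirected graph.
\<close>

definition one_input_regular :: "'c::finite rel \<Rightarrow> bool" where
  "one_input_regular E \<longleftrightarrow>
     (\<forall>c. \<exists>!b. (b, c) \<in> E) \<and> (\<forall>b c. (b, c) \<in> (E \<union> E\<inverse>)\<^sup>*)"

definition input :: "'c rel \<Rightarrow> 'c \<Rightarrow> 'c" where
  "input E c = (THE b. (b, c) \<in> E)"


section \<open>Ring, rooted trees, subtrees\<close>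

text \<open>
  A connected network in which each cell receives exactly one edge has exactly one directed cycle;
  the ring consists of the cells on it. Removing its edges leaves the disjoint union of the rooted
  trees, one for each ring cell. For a ring cell to which nothing is attached this tree is a single
  cell.
\<close>

definition ring :: "'c rel \<Rightarrow> 'c set" where
  "ring E = {c. (c, c) \<in> E\<^sup>+}"

definition ring_edges :: "'c rel \<Rightarrow> 'c rel" where
  "ring_edges E = E \<inter> ring E \<times> ring E"

definition tree_edges :: "'c rel \<Rightarrow> 'c rel" where
  "tree_edges E = E - ring_edges E"

definition tree_cells :: "'c rel \<Rightarrow> 'c \<Rightarrow> 'c set" where
  "tree_cells E \<rho> = {c. (\<rho>, c) \<in> (tree_edges E)\<^sup>*}"

text \<open>
  Leaves of the rooted trees. Ring cells always have an outgoing edge, hence are never leaves here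
  (not even when their tree is a single cell).
\<close>

definition leaves :: "'c rel \<Rightarrow> 'c set" where
  "leaves E = {c. \<nexists>d. (c, d) \<in> E}"

text \<open>The cells of the ring, listed once each in the order in which the edges traverse them.\<close>

definition ring_listing :: "'c rel \<Rightarrow> 'c list \<Rightarrow> bool" where
  "ring_listing E ps \<longleftrightarrow> distinct ps \<and> set ps = ring E \<and>
     (\<forall>j<length ps. (ps ! j, ps ! (Suc j mod length ps)) \<in> E)"

text \<open>
  A connected subgraph of a tree contains every tree edge between two of its cells, so it is
  represented by its nonempty set of cells.
\<close>

definition edges_in :: "'c rel \<Rightarrow> 'c set \<Rightarrow> 'c rel" where
  "edges_in E B = tree_edges E \<inter> B \<times> B"

definition subtree :: "'c rel \<Rightarrow> 'c set \<Rightarrow> bool" where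
  "subtree E B \<longleftrightarrow> B \<noteq> {} \<and> (\<exists>\<rho>\<in>ring E. B \<subseteq> tree_cells E \<rho>) \<and>
     (\<forall>b\<in>B. \<forall>c\<in>B. (b, c) \<in> (edges_in E B \<union> (edges_in E B)\<inverse>)\<^sup>*)"

definition subtree_root :: "'c rel \<Rightarrow> 'c set \<Rightarrow> 'c" where
  "subtree_root E B = (THE \<rho>. \<rho> \<in> B \<and> (\<forall>c\<in>B. (\<rho>, c) \<in> (edges_in E B)\<^sup>*))"

definition root_dist :: "'c rel \<Rightarrow> 'c set \<Rightarrow> 'c \<Rightarrow> nat" where
  "root_dist E B c = (THE k. (subtree_root E B, c) \<in> edges_in E B ^^ k)"

definition subtree_leaves :: "'c rel \<Rightarrow> 'c set \<Rightarrow> 'c set" where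
  "subtree_leaves E B = {c \<in> B. \<nexists>d. (c, d) \<in> edges_in E B}"

definition depth :: "'c rel \<Rightarrow> 'c set \<Rightarrow> nat" where
  "depth E B = (if subtree_leaves E B = {} then 0 else Max (root_dist E B ` subtree_leaves E B))"

text \<open>
  Wrapping the trees over the ring: the relation says that cell c is laid over ring cell p. A ring
  cell, as the root of its own tree (k = 0), is laid over itself.
\<close>

definition laid_over :: "'c rel \<Rightarrow> 'c \<Rightarrow> 'c \<Rightarrow> bool" where
  "laid_over E c p \<longleftrightarrow>
     (\<exists>\<rho>\<in>ring E. \<exists>k. (\<rho>, c) \<in> tree_edges E ^^ k \<and> (\<rho>, p) \<in> ring_edges E ^^ k)"

definition overlapping :: "'c rel \<Rightarrow> 'c \<Rightarrow> 'c \<Rightarrow> bool" where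
  "overlapping E c d \<longleftrightarrow> (\<exists>p. laid_over E c p \<and> laid_over E d p)"


section \<open>Synchrony subspaces and balanced colourings\<close>

primrec C_k :: "nat \<Rightarrow> (real \<times> real \<Rightarrow> real) \<Rightarrow> bool" where
  "C_k 0 f \<longleftrightarrow> continuous_on UNIV f"
| "C_k (Suc k) f \<longleftrightarrow>
     (\<exists>f1 f2. (\<forall>p. (f has_derivative (\<lambda>h. f1 p * fst h + f2 p * snd h)) (at p)) \<and>
              C_k k f1 \<and> C_k k f2)"

definition smooth :: "(real \<times> real \<Rightarrow> real) \<Rightarrow> bool" where
  "smooth f \<longleftrightarrow> (\<forall>k. C_k k f)"

definition coupled_field ::
    "'c::finite rel \<Rightarrow> (real \<times> real \<Rightarrow> real) \<Rightarrow> real ^ 'c \<Rightarrow> real ^ 'c" where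
  "coupled_field E f x = (\<chi> c. f (x $ c, x $ input E c))"

definition flow_invariant :: "(real ^ 'c::finite \<Rightarrow> real ^ 'c) \<Rightarrow> (real ^ 'c) set \<Rightarrow> bool" where
  "flow_invariant F S \<longleftrightarrow>
     (\<forall>T x. is_interval T \<longrightarrow> 0 \<in> T \<longrightarrow>
        (\<forall>t\<in>T. (x has_vector_derivative F (x t)) (at t within T)) \<longrightarrow>
        x 0 \<in> S \<longrightarrow> (\<forall>t\<in>T. x t \<in> S))"

definition sync_space :: "'c::finite rel \<Rightarrow> (real ^ 'c) set" where
  "sync_space R = {x. \<forall>c d. (c, d) \<in> R \<longrightarrow> x $ c = x $ d}"

definition synchrony_subspace :: "'c::finite rel \<Rightarrow> (real ^ 'c) set \<Rightarrow> bool" where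
  "synchrony_subspace E S \<longleftrightarrow>
     (\<exists>R. equiv UNIV R \<and> S = sync_space R) \<and>
     (\<forall>f. smooth f \<longrightarrow> flow_invariant (coupled_field E f) S)"

text \<open>
  The join is the sum of subspaces. The two summands only have to differ from S; allowing them to
  coincide changes nothing, as the sum would then be that summand.
\<close>

definition join_irreducible :: "'c::finite rel \<Rightarrow> (real ^ 'c) set \<Rightarrow> bool" where
  "join_irreducible E S \<longleftrightarrow> synchrony_subspace E S \<and>
     \<not> (\<exists>S1 S2. synchrony_subspace E S1 \<and> synchrony_subspace E S2 \<and> S1 \<noteq> S \<and> S2 \<noteq> S \<and>
          S = {u + v | u v. u \<in> S1 \<and> v \<in> S2})"

definition same_colour :: "('c \<Rightarrow> 'k) \<Rightarrow> 'c rel" where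
  "same_colour \<kappa> = {(c, d). \<kappa> c = \<kappa> d}"

definition balanced :: "'c rel \<Rightarrow> ('c \<Rightarrow> 'k) \<Rightarrow> bool" where
  "balanced E \<kappa> \<longleftrightarrow> (\<forall>c d. \<kappa> c = \<kappa> d \<longrightarrow> \<kappa> (input E c) = \<kappa> (input E d))"

end

theory Submission
  imports Defs
begin

text \<open>
  Let \<open>\<phi>\<close> send a cell to the tail of its input edge. A balanced colouring \<open>\<kappa>\<close> is one for which \<open>\<phi>\<close>
  descends to a map \<open>g\<close> on colours, so the colours form a connected one-input network of their own,
  and the synchrony subspaces inside the subspace of \<open>\<kappa>\<close> are those of the balanced colourings
  coarser than \<open>\<kappa>\<close>.

  The engine is a criterion for reducibility. If two colours \<open>p\<close>, \<open>q\<close> have \<open>g p = g q\<close>, then merging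
  just these two is balanced and costs one dimension. That dimension is recovered by any other proper
  balanced coarsening that leaves \<open>p\<close> alone, because its subspace contains the indicator of \<open>p\<close>; the
  subspace of \<open>\<kappa>\<close> is then the sum of two smaller ones (\<open>no_independent_merging\<close>). Two different
  mergeable pairs are impossible by this criterion, as one of the pairs has a colour outside the other
  (\<open>mergeable_pair_unique\<close>). A mergeable pair together with a ring of at least two colours is
  impossible too: \<open>g\<close> is injective on ring colours, so one colour of the pair is absent from the ring,
  and all ring colours can be merged into one without touching it (\<open>ring_monochromatic\<close>).

  So one of two things happens. If \<open>g\<close> is injective, the colour of a cell is determined by the colour
  of any ancestor of known order, hence by the ring cell that it is laid over. The colours along the
  ring form a purely periodic sequence, and its minimal period \<open>k\<close>, a divisor of \<open>m\<close>, decides between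
  the first three alternatives: \<open>k = 1\<close>, \<open>1 < k < m\<close> and \<open>k = m\<close>.

  Otherwise the ring has a single colour \<open>r\<close>, and the unique mergeable pair consists of \<open>r\<close> and the
  colour of the cells that are fed by colour \<open>r\<close> without having it. Away from \<open>r\<close> the map \<open>g\<close> is then
  injective, so the colours form a path ending in a loop at \<open>r\<close>, and a colour is the same thing as its
  distance to \<open>r\<close> along this path, called the level below. If only levels 0 and 1 occur, the cells of
  level 1 are leaves and the fourth alternative holds. If not, the cells that enter colour \<open>r\<close> at the
  same cell form a subtree rooted there, in which distance from the root is the level, and these
  subtrees give the fifth alternative.

  All of this needs that a balanced colouring yields a flow-invariant subspace. That is uniqueness for
  the differential equation satisfied by the differences of equally coloured coordinates, obtained by
  a Gronwall argument for the sum of their squares (\<open>synchrony_subspace_of_balanced\<close>).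
\<close>

section \<open>Balanced colourings give flow-invariant subspaces\<close>

text \<open>
  Only one continuous derivative enters: the partial derivatives are bounded on the compact convex ball,
  and their bounds add up to a Lipschitz constant by the mean value inequality.
\<close>

lemma lipschitz_on_ball_of_smooth:
  assumes "smooth f"
  obtains L where "L \<ge> 0"
    "\<And>p q. p \<in> cball 0 b \<Longrightarrow> q \<in> cball 0 b \<Longrightarrow> \<bar>f p - f q\<bar> \<le> L * norm (p - q)"
proof -
  have "C_k (Suc 0) f"
    using assms unfolding smooth_def by blast
  then obtain f1 f2 where
    der: "\<And>p. (f has_derivative (\<lambda>h. f1 p * fst h + f2 p * snd h)) (at p)"
    and cont: "continuous_on UNIV f1" "continuous_on UNIV f2"
    by auto
  have "\<exists>M\<ge>0. \<forall>p\<in>cball 0 b. \<bar>g p\<bar> \<le> M" if "continuous_on UNIV g" for g :: "real \<times> real \<Rightarrow> real"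
  proof -
    have "bounded (g ` cball 0 b)"
      by (intro compact_imp_bounded compact_continuous_image continuous_on_subset[OF that]) auto
    then obtain M where "\<forall>y\<in>g ` cball 0 b. norm y \<le> M"
      unfolding bounded_iff by blast
    then show ?thesis
      by (intro exI[of _ "max M 0"]) (auto simp: le_max_iff_disj)
  qed
  then obtain M1 M2 where M: "M1 \<ge> 0" "M2 \<ge> 0"
    "\<And>p. p \<in> cball 0 b \<Longrightarrow> \<bar>f1 p\<bar> \<le> M1" "\<And>p. p \<in> cball 0 b \<Longrightarrow> \<bar>f2 p\<bar> \<le> M2"
    using cont by metis
  have onorm_le_M: "onorm (\<lambda>h. f1 p * fst h + f2 p * snd h) \<le> M1 + M2" if p: "p \<in> cball 0 b" for p
  proof (rule onorm_le)
    fix h :: "real \<times> real"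
    have "\<bar>fst h\<bar> \<le> norm h" "\<bar>snd h\<bar> \<le> norm h"
      using norm_fst_le[of "fst h" "snd h"] norm_snd_le[of "snd h" "fst h"] by auto
    then have "\<bar>f1 p * fst h\<bar> \<le> M1 * norm h" "\<bar>f2 p * snd h\<bar> \<le> M2 * norm h"
      unfolding abs_mult using M(1,2) M(3,4)[OF p] by (intro mult_mono; simp)+
    then show "norm (f1 p * fst h + f2 p * snd h) \<le> (M1 + M2) * norm h"
      by (simp add: distrib_right)
  qed
  have "norm (f p - f q) \<le> (M1 + M2) * norm (p - q)"
    if "p \<in> cball 0 b" "q \<in> cball 0 b" for p q
    by (rule differentiable_bound[of "cball 0 b" f "\<lambda>p h. f1 p * fst h + f2 p * snd h"])
      (rule convex_cball has_derivative_at_withinI[OF der] onorm_le_M that; assumption?)+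
  then show thesis
    using M(1,2) by (intro that[of "M1 + M2"]) (simp_all only: real_norm_def add_nonneg_nonneg)
qed

text \<open>
  Gronwall's inequality with initial value zero. Substituting \<open>s = u t\<close> with \<open>u\<close> in the unit interval
  treats positive and negative \<open>t\<close> alike; the factor \<open>exp (- \<bar>t\<bar> K u)\<close> then makes the function
  nonincreasing in \<open>u\<close>.
\<close>

lemma gronwall_vanishing:
  fixes W :: "real \<Rightarrow> real"
  assumes "is_interval T" "0 \<in> T" "t \<in> T"
    and der: "\<And>s. s \<in> closed_segment 0 t \<Longrightarrow> (W has_real_derivative W' s) (at s within T)"
    and bound: "\<And>s. s \<in> closed_segment 0 t \<Longrightarrow> \<bar>W' s\<bar> \<le> K * W s"
    and "W 0 = 0"
  shows "W t \<le> 0"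
proof -
  define V where "V u = exp (- (\<bar>t\<bar> * K) * u) * W (u * t)" for u
  define V' where "V' u = exp (- (\<bar>t\<bar> * K) * u) * (W' (u * t) * t - \<bar>t\<bar> * K * W (u * t))" for u
  have seg: "u * t \<in> closed_segment 0 t" if "u \<in> {0..1}" for u
    using that by (auto simp: in_segment)
  have segT: "closed_segment 0 t \<subseteq> T"
    using assms(1-3) by (simp add: closed_segment_subset is_interval_convex)
  have dV: "(V has_real_derivative V' u) (at u within {0..1})" if u: "u \<in> {0..1}" for u
  proof -
    have "(\<lambda>u. u * t) ` {0..1} \<subseteq> T"
      using seg segT by blast
    then have "(W has_real_derivative W' (u * t)) (at (u * t) within (\<lambda>u. u * t) ` {0..1})"
      using der[OF seg[OF u]] has_field_derivative_subset by blast
    then have "((W \<circ> (\<lambda>u. u * t)) has_real_derivative W' (u * t) * t) (at u within {0..1})"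
      by (rule DERIV_image_chain) (auto intro!: derivative_eq_intros)
    then have [derivative_intros]:
      "((\<lambda>u. W (u * t)) has_real_derivative W' (u * t) * t) (at u within {0..1})"
      by (simp add: o_def)
    show ?thesis
      unfolding V_def[abs_def] V'_def
      by (auto intro!: derivative_eq_intros simp: algebra_simps)
  qed
  have "V' u \<le> 0" if u: "u \<in> {0..1}" for u
  proof -
    have "W' (u * t) * t \<le> \<bar>W' (u * t)\<bar> * \<bar>t\<bar>"
      by (metis abs_ge_self abs_mult)
    also have "\<dots> \<le> (K * W (u * t)) * \<bar>t\<bar>"
      using bound[OF seg[OF u]] by (intro mult_right_mono) auto
    finally show ?thesis
      unfolding V'_def by (intro mult_nonneg_nonpos) (auto simp: algebra_simps)
  qed
  moreover have "\<exists>u\<in>{0..1}. V 1 - V 0 = V' u * (1 - 0)"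
    using dV by (intro mvt_very_simple) (auto simp: has_field_derivative_def)
  ultimately have "V 1 \<le> V 0"
    by force
  then show ?thesis
    using assms(6) by (simp add: V_def mult_le_0_iff)
qed

lemma balancedD: "balanced E \<kappa> \<Longrightarrow> \<kappa> c = \<kappa> d \<Longrightarrow> \<kappa> (input E c) = \<kappa> (input E d)"
  unfolding balanced_def by blast

text \<open>
  Along a solution let \<open>W\<close> be the sum of the squared differences \<open>z\<close> of equally coloured coordinates.
  The derivative of such a difference is bounded, via a Lipschitz constant of \<open>f\<close>, by the difference
  itself and that of the two input cells. By balance the input cells have equal colours as well, so
  their difference is again one of the summands and \<open>\<bar>W'\<bar>\<close> is bounded by a multiple of \<open>W\<close>.
\<close>

lemma synchrony_subspace_of_balanced:
  fixes E :: "'c::finite rel"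
  assumes "balanced E \<kappa>"
  shows "synchrony_subspace E (sync_space (same_colour \<kappa>))"
  unfolding synchrony_subspace_def flow_invariant_def
proof (intro conjI allI impI ballI)
  have "equiv UNIV (same_colour \<kappa>)"
    by (rule equivI) (auto simp: same_colour_def refl_on_def sym_def trans_def)
  then show "\<exists>R'. equiv UNIV R' \<and> sync_space (same_colour \<kappa>) = sync_space R'"
    by blast
next
  define R where "R = same_colour \<kappa>"
  have bal: "(input E c, input E d) \<in> R" if "(c, d) \<in> R" for c d
    using balancedD[OF assms, of c d] that by (simp add: R_def same_colour_def)
  fix f T and x :: "real \<Rightarrow> real ^ 'c" and t
  assume f: "smooth f" and T: "is_interval T" "0 \<in> T" "t \<in> T"
    and sol: "\<forall>s\<in>T. (x has_vector_derivative coupled_field E f (x s)) (at s within T)"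
    and "x 0 \<in> sync_space (same_colour \<kappa>)"
  then have init: "x 0 \<in> sync_space R"
    by (simp add: R_def)
  \<comment> \<open>Only the times between 0 and the given one matter; the solution stays bounded there.\<close>
  have segT: "closed_segment 0 t \<subseteq> T"
    using T by (simp add: closed_segment_subset is_interval_convex)
  have "continuous_on T x"
    using sol by (auto simp: continuous_on_eq_continuous_within
        intro: has_vector_derivative_continuous)
  then have "bounded (x ` closed_segment 0 t)"
    by (intro compact_imp_bounded compact_continuous_image continuous_on_subset[OF _ segT]) auto
  then obtain b where b: "\<And>s. s \<in> closed_segment 0 t \<Longrightarrow> norm (x s) \<le> b"
    unfolding bounded_iff by blast
  \<comment> \<open>By compactness of the time segment, all arguments of the coupling function stay in one ball.\<close>
  have in_ball: "(x s $ c, x s $ d) \<in> cball 0 (2 * b)" if "s \<in> closed_segment 0 t" for s c d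
    using norm_Pair_le[of "x s $ c" "x s $ d"] b[OF that]
      component_le_norm_cart[of "x s" c] component_le_norm_cart[of "x s" d] by simp
  obtain L where L: "L \<ge> 0" "\<And>p q. p \<in> cball 0 (2 * b) \<Longrightarrow> q \<in> cball 0 (2 * b)
      \<Longrightarrow> \<bar>f p - f q\<bar> \<le> L * norm (p - q)"
    using lipschitz_on_ball_of_smooth[OF f] by blast
  define z where "z e s = x s $ fst e - x s $ snd e" for e s
  define z' where "z' e s = f (x s $ fst e, x s $ input E (fst e))
      - f (x s $ snd e, x s $ input E (snd e))" for e s
  define W where "W s = (\<Sum>e\<in>R. (z e s)\<^sup>2)" for s
  define W' where "W' s = (\<Sum>e\<in>R. 2 * z e s * z' e s)" for s
  have dx: "((\<lambda>s. x s $ c) has_real_derivative f (x s $ c, x s $ input E c)) (at s within T)"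
    if "s \<in> T" for s c
    using bounded_linear.has_vector_derivative[OF bounded_linear_vec_nth[of c], of x
        "coupled_field E f (x s)"] sol that
    by (auto simp: has_real_derivative_iff_has_vector_derivative coupled_field_def)
  have dz: "(z e has_real_derivative z' e s) (at s within T)" if "s \<in> T" for s e
    unfolding z_def[abs_def] z'_def using that by (intro DERIV_diff dx)
  have "(W has_real_derivative W' s) (at s within T)" if "s \<in> T" for s
    unfolding W_def[abs_def] W'_def
    by (intro DERIV_sum) (auto intro!: derivative_eq_intros dz that)
  moreover have "\<bar>W' s\<bar> \<le> (real (card R) * (4 * L)) * W s" if s: "s \<in> closed_segment 0 t" for s
  proof -
    have term_le: "(z e s)\<^sup>2 \<le> W s" if "e \<in> R" for e
      unfolding W_def using that by (intro member_le_sum) auto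
    have "\<bar>2 * z e s * z' e s\<bar> \<le> 4 * L * W s" if e: "e \<in> R" for e
    proof -
      define i where "i = (input E (fst e), input E (snd e))"
      have "i \<in> R"
        using bal e by (simp add: i_def)
      have "\<bar>z' e s\<bar> \<le> L * norm ((x s $ fst e, x s $ input E (fst e))
          - (x s $ snd e, x s $ input E (snd e)))"
        unfolding z'_def by (intro L in_ball s)
      also have "\<dots> \<le> L * (\<bar>z e s\<bar> + \<bar>z i s\<bar>)"
        using norm_Pair_le[of "z e s" "z i s"] L(1)
        by (auto simp: z_def i_def intro!: mult_left_mono)
      finally have "2 * \<bar>z e s\<bar> * \<bar>z' e s\<bar> \<le> 2 * \<bar>z e s\<bar> * (L * (\<bar>z e s\<bar> + \<bar>z i s\<bar>))"
        by (intro mult_left_mono) auto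
      also have "\<dots> = L * (2 * (z e s)\<^sup>2 + 2 * \<bar>z e s\<bar> * \<bar>z i s\<bar>)"
        by (simp add: algebra_simps power2_eq_square)
      also have "\<dots> \<le> L * (4 * W s)"
        using term_le[OF e] term_le[OF \<open>i \<in> R\<close>] sum_squares_bound[of "\<bar>z e s\<bar>" "\<bar>z i s\<bar>"] L(1)
        by (intro mult_left_mono) auto
      finally show ?thesis
        by (simp add: abs_mult)
    qed
    then have "(\<Sum>e\<in>R. \<bar>2 * z e s * z' e s\<bar>) \<le> real (card R) * (4 * L * W s)"
      by (intro sum_bounded_above) auto
    then have "\<bar>W' s\<bar> \<le> real (card R) * (4 * L * W s)"
      unfolding W'_def by (rule order_trans[OF sum_abs])
    then show ?thesis
      by (simp add: mult.assoc)
  qed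
  moreover have "W 0 = 0"
    using init by (auto simp: W_def z_def sync_space_def intro!: sum.neutral)
  ultimately have "W t \<le> 0"
    using gronwall_vanishing[OF T, of W W'] segT by blast
  moreover have "W t \<ge> 0"
    unfolding W_def by (simp add: sum_nonneg)
  ultimately have "(\<Sum>e\<in>R. (z e t)\<^sup>2) = 0"
    by (simp add: W_def)
  then have "\<forall>e\<in>R. z e t = 0"
    by (subst (asm) sum_nonneg_eq_0_iff) auto
  then show "x t \<in> sync_space (same_colour \<kappa>)"
    by (auto simp: z_def sync_space_def R_def)
qed

section \<open>Which colour classes can be merged\<close>

text \<open>Colour \<open>p\<close> is repainted as \<open>q\<close>, which stays within the same colour type.\<close>

definition merge_colours :: "'k \<Rightarrow> 'k \<Rightarrow> ('c \<Rightarrow> 'k) \<Rightarrow> 'c \<Rightarrow> 'k" where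
  "merge_colours p q \<kappa> c = (if \<kappa> c = p then q else \<kappa> c)"

lemma merge_colours_eq_iff:
  "merge_colours (\<kappa> a) (\<kappa> b) \<kappa> c = merge_colours (\<kappa> a) (\<kappa> b) \<kappa> d \<longleftrightarrow>
    \<kappa> c = \<kappa> d \<or> \<kappa> c \<in> {\<kappa> a, \<kappa> b} \<and> \<kappa> d \<in> {\<kappa> a, \<kappa> b}"
  by (auto simp: merge_colours_def)

lemma balanced_merge_colours:
  assumes "balanced E \<kappa>" "\<kappa> (input E a) = \<kappa> (input E b)"
  shows "balanced E (merge_colours (\<kappa> a) (\<kappa> b) \<kappa>)"
  unfolding balanced_def
proof (intro allI impI)
  have bal: "\<kappa> c = \<kappa> d \<Longrightarrow> \<kappa> (input E c) = \<kappa> (input E d)" for c d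
    using assms(1) by (rule balancedD)
  then have to_a: "\<kappa> (input E c) = \<kappa> (input E a)" if "\<kappa> c \<in> {\<kappa> a, \<kappa> b}" for c
    using that assms(2) by (metis insert_iff singletonD)
  fix c d assume "merge_colours (\<kappa> a) (\<kappa> b) \<kappa> c = merge_colours (\<kappa> a) (\<kappa> b) \<kappa> d"
  then have "\<kappa> (input E c) = \<kappa> (input E d)"
    using bal to_a by (metis merge_colours_eq_iff)
  then show "merge_colours (\<kappa> a) (\<kappa> b) \<kappa> (input E c) = merge_colours (\<kappa> a) (\<kappa> b) \<kappa> (input E d)"
    by (simp add: merge_colours_def)
qed

lemma in_sync_space_same_colour_iff:
  "x \<in> sync_space (same_colour \<kappa>) \<longleftrightarrow> (\<forall>c d. \<kappa> c = \<kappa> d \<longrightarrow> x $ c = x $ d)"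
  by (simp add: sync_space_def same_colour_def)

lemma sync_space_neq_of_merged_cells:
  fixes \<kappa> :: "'c::finite \<Rightarrow> 'k"
  assumes "\<kappa> c \<noteq> \<kappa> d" "\<mu> c = \<mu> d"
  shows "sync_space (same_colour \<mu>) \<noteq> sync_space (same_colour \<kappa>)"
proof -
  define x :: "real ^ 'c" where "x = (\<chi> e. if \<kappa> e = \<kappa> c then 1 else 0)"
  have "x \<in> sync_space (same_colour \<kappa>)"
    by (auto simp: x_def sync_space_def same_colour_def)
  moreover have "x $ c \<noteq> x $ d"
    using assms(1) by (simp add: x_def)
  then have "x \<notin> sync_space (same_colour \<mu>)"
    using assms(2) by (auto simp: sync_space_def same_colour_def)
  ultimately show ?thesis
    by blast
qed

text \<open>
  The criterion for reducibility, in contrapositive form. If \<open>\<mu>\<close> leaves the class of \<open>a\<close> alone, then any \<open>x\<close>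
  in the subspace of \<open>\<kappa>\<close> splits as \<open>(x - v) + v\<close>: take for \<open>v\<close> the multiple of the indicator of the class of \<open>a\<close>
  for which \<open>x - v\<close> has equal values at \<open>a\<close> and \<open>b\<close>. Then \<open>v\<close> is compatible with \<open>\<mu>\<close>, and \<open>x - v\<close> with the
  merging of \<open>a\<close> and \<open>b\<close>, and both colourings are strictly coarser than \<open>\<kappa>\<close>.
\<close>

lemma no_independent_merging:
  fixes E :: "'c::finite rel" and \<kappa> :: "'c \<Rightarrow> 'k" and \<mu> :: "'c \<Rightarrow> 'l"
  assumes bal: "balanced E \<kappa>" and irr: "join_irreducible E (sync_space (same_colour \<kappa>))"
    and ab: "\<kappa> a \<noteq> \<kappa> b" "\<kappa> (input E a) = \<kappa> (input E b)"
    and \<mu>: "balanced E \<mu>" "\<And>c d. \<kappa> c = \<kappa> d \<Longrightarrow> \<mu> c = \<mu> d" "\<exists>c d. \<kappa> c \<noteq> \<kappa> d \<and> \<mu> c = \<mu> d"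
  shows "\<exists>c. \<mu> c = \<mu> a \<and> \<kappa> c \<noteq> \<kappa> a"
proof (rule ccontr)
  assume iso: "\<not> ?thesis"
  define \<nu> where "\<nu> = merge_colours (\<kappa> a) (\<kappa> b) \<kappa>"
  have \<nu>_eq: "\<nu> c = \<nu> d \<longleftrightarrow> \<kappa> c = \<kappa> d \<or> \<kappa> c \<in> {\<kappa> a, \<kappa> b} \<and> \<kappa> d \<in> {\<kappa> a, \<kappa> b}" for c d
    unfolding \<nu>_def by (rule merge_colours_eq_iff)
  let ?S = "sync_space (same_colour \<kappa>)"
  let ?S1 = "sync_space (same_colour \<nu>)"
  let ?S2 = "sync_space (same_colour \<mu>)"
  have "synchrony_subspace E ?S1" "synchrony_subspace E ?S2"
    using balanced_merge_colours[OF bal ab(2)] \<mu>(1)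
    by (simp_all add: \<nu>_def synchrony_subspace_of_balanced)
  moreover have "?S1 \<noteq> ?S"
    using sync_space_neq_of_merged_cells[of \<kappa> a b \<nu>] ab(1) \<nu>_eq by blast
  moreover have "?S2 \<noteq> ?S"
    using sync_space_neq_of_merged_cells[of \<kappa> _ _ \<mu>] \<mu>(3) by blast
  moreover have "?S = {u + v | u v. u \<in> ?S1 \<and> v \<in> ?S2}"
  proof (intro equalityI subsetI)
    fix x assume "x \<in> ?S"
    then have x: "\<kappa> c = \<kappa> d \<Longrightarrow> x $ c = x $ d" for c d
      unfolding in_sync_space_same_colour_iff by blast
    define v :: "real ^ 'c" where "v = (\<chi> c. if \<kappa> c = \<kappa> a then x $ a - x $ b else 0)"
    have "v $ c = v $ d" if "\<mu> c = \<mu> d" for c d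
    proof -
      have "\<kappa> c = \<kappa> a \<longleftrightarrow> \<kappa> d = \<kappa> a"
        using iso \<mu>(2) that by metis
      then show ?thesis
        by (simp add: v_def)
    qed
    then have "v \<in> ?S2"
      unfolding in_sync_space_same_colour_iff by blast
    moreover have "x - v \<in> ?S1"
    proof -
      have v_ab: "(x - v) $ c = x $ b" if "\<kappa> c \<in> {\<kappa> a, \<kappa> b}" for c
        using that x[of c a] x[of c b] ab(1) by (auto simp: v_def)
      have "(x - v) $ c = (x - v) $ d" if "\<kappa> c = \<kappa> d" for c d
        using x[OF that] that by (simp add: v_def)
      then show ?thesis
        unfolding in_sync_space_same_colour_iff using v_ab \<nu>_eq by metis
    qed
    moreover have "x = (x - v) + v"
      by simp
    ultimately show "x \<in> {u + v | u v. u \<in> ?S1 \<and> v \<in> ?S2}"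
      by blast
  next
    fix x assume "x \<in> {u + v | u v. u \<in> ?S1 \<and> v \<in> ?S2}"
    then obtain u v where "x = u + v" "u \<in> ?S1" "v \<in> ?S2"
      by blast
    moreover have "\<nu> c = \<nu> d" if "\<kappa> c = \<kappa> d" for c d
      using that \<nu>_eq[of c d] by blast
    ultimately show "x \<in> ?S"
      unfolding in_sync_space_same_colour_iff using \<mu>(2) by (metis vector_add_component)
  qed
  ultimately show False
    using irr unfolding join_irreducible_def by blast
qed

text \<open>
  Were the colour of \<open>a\<close> outside the second pair, merging that pair would leave it alone, against the
  criterion above. As the two pairs are arbitrary, they consist of the same two colours.
\<close>

lemma mergeable_pair_unique:
  fixes E :: "'c::finite rel" and \<kappa> :: "'c \<Rightarrow> 'k"
  assumes bal: "balanced E \<kappa>" and irr: "join_irreducible E (sync_space (same_colour \<kappa>))"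
    and ab: "\<kappa> a \<noteq> \<kappa> b" "\<kappa> (input E a) = \<kappa> (input E b)"
    and cd: "\<kappa> c \<noteq> \<kappa> d" "\<kappa> (input E c) = \<kappa> (input E d)"
  shows "\<kappa> a \<in> {\<kappa> c, \<kappa> d}"
proof -
  define \<mu> where "\<mu> = merge_colours (\<kappa> c) (\<kappa> d) \<kappa>"
  have \<mu>_eq: "\<mu> e = \<mu> e' \<longleftrightarrow> \<kappa> e = \<kappa> e' \<or> \<kappa> e \<in> {\<kappa> c, \<kappa> d} \<and> \<kappa> e' \<in> {\<kappa> c, \<kappa> d}" for e e'
    unfolding \<mu>_def by (rule merge_colours_eq_iff)
  have "balanced E \<mu>"
    unfolding \<mu>_def using bal cd(2) by (rule balanced_merge_colours)
  moreover have "\<mu> e = \<mu> e'" if "\<kappa> e = \<kappa> e'" for e e'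
    using that \<mu>_eq[of e e'] by blast
  moreover have "\<mu> c = \<mu> d"
    using \<mu>_eq[of c d] by blast
  then have "\<exists>e e'. \<kappa> e \<noteq> \<kappa> e' \<and> \<mu> e = \<mu> e'"
    using cd(1) by blast
  ultimately have "\<exists>e. \<mu> e = \<mu> a \<and> \<kappa> e \<noteq> \<kappa> a"
    by (rule no_independent_merging[OF bal irr ab])
  then obtain e where "\<mu> e = \<mu> a" "\<kappa> e \<noteq> \<kappa> a"
    by blast
  then show ?thesis
    using \<mu>_eq[of e a] by blast
qed

section \<open>The ring and the input map\<close>

text \<open>
  If each term of a sequence determines the next and the initial term comes back, the first return time
  is the exact period, and equality of terms is congruence of indices: two equal terms strictly inside
  one period, shifted until the later one reaches its end, would give an earlier return. The lemma
  serves twice, for the cells along the ring and for their colours.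
\<close>

lemma purely_periodic_sequence:
  fixes s :: "nat \<Rightarrow> 'a"
  assumes det: "\<And>i j. s i = s j \<Longrightarrow> s (Suc i) = s (Suc j)"
    and "0 < n" "s n = s 0"
  obtains k where "0 < k" "k dvd n" "\<And>i j. s i = s j \<longleftrightarrow> i mod k = j mod k"
proof -
  define k where "k = (LEAST k. 0 < k \<and> s k = s 0)"
  have "0 < k \<and> s k = s 0"
    unfolding k_def by (rule LeastI[of _ n]) (use assms(2,3) in simp)
  then have k: "0 < k" "s k = s 0"
    by simp_all
  have min: "s l \<noteq> s 0" if "0 < l" "l < k" for l
    using not_less_Least[of l "\<lambda>k. 0 < k \<and> s k = s 0"] that by (simp add: k_def)
  have shift: "s (i + l) = s (j + l)" if "s i = s j" for i j l
  proof (induction l)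
    case (Suc l)
    show ?case
      using det[OF Suc] by simp
  qed (simp add: that)
  have "s (i + q * k) = s i" for i q
  proof (induction q)
    case (Suc q)
    have "s (k + (i + q * k)) = s (0 + (i + q * k))"
      by (rule shift[OF k(2)])
    with Suc show ?case
      by (simp add: add_ac)
  qed simp
  then have s_mod: "s i = s (i mod k)" for i
    using mod_mult_div_eq[of i k] by (metis mult.commute)
  have inj: "\<not> s i = s j" if "i < j" "j < k" for i j
  proof
    assume "s i = s j"
    then have "s (i + (k - j)) = s (j + (k - j))"
      by (rule shift)
    then have "s (i + (k - j)) = s 0"
      using k(2) that by simp
    moreover have "s (i + (k - j)) \<noteq> s 0"
      by (rule min) (use that in linarith)+
    ultimately show False
      by contradiction
  qed
  have eq: "s i = s j \<longleftrightarrow> i mod k = j mod k" for i j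
  proof
    assume "s i = s j"
    then have "s (i mod k) = s (j mod k)"
      using s_mod by metis
    then show "i mod k = j mod k"
      using inj[of "i mod k" "j mod k"] inj[of "j mod k" "i mod k"] k(1)
      by (metis linorder_neqE_nat mod_less_divisor)
  next
    assume "i mod k = j mod k"
    then show "s i = s j"
      using s_mod by metis
  qed
  have "k dvd n"
    using eq[of n 0] assms(3) by (simp add: dvd_eq_mod_eq_0)
  with k(1) eq show thesis
    using that by blast
qed

lemma map_upt_eq_concat_replicate:
  assumes "\<And>j. j < d * k \<Longrightarrow> g j = g (j mod k)"
  shows "map g [0..<d * k] = concat (replicate d (map g [0..<k]))"
  using assms
proof (induction d)
  case (Suc d)
  have "map g [d * k..<d * k + k] = map g [0..<k]"
  proof (rule nth_equalityI)
    fix i assume "i < length (map g [d * k..<d * k + k])"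
    then show "map g [d * k..<d * k + k] ! i = map g [0..<k] ! i"
      using Suc.prems[of "d * k + i"] by simp
  qed simp
  moreover have "map g [0..<Suc d * k] = map g [0..<d * k] @ map g [d * k..<d * k + k]"
    using upt_add_eq_append[of 0 "d * k" k] by (simp add: add.commute)
  moreover have "map g [0..<d * k] = concat (replicate d (map g [0..<k]))"
    by (rule Suc.IH, rule Suc.prems) simp
  moreover have "replicate (Suc d) (map g [0..<k]) = replicate d (map g [0..<k]) @ [map g [0..<k]]"
    by (simp add: replicate_append_same)
  ultimately show ?case
    by (simp only: concat_append) simp
qed simp

lemma relpow_mono:
  fixes A B :: "'a rel"
  assumes "A \<subseteq> B" "(b, c) \<in> A ^^ k"
  shows "(b, c) \<in> B ^^ k"
  using assms(2)
proof (induction k arbitrary: c)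
  case (Suc k)
  from Suc.prems obtain y where "(b, y) \<in> A ^^ k" "(y, c) \<in> A"
    by (rule relpow_Suc_E)
  then have "(b, y) \<in> B ^^ k" "(y, c) \<in> B"
    using Suc.IH assms(1) by auto
  then show ?case
    by (rule relpow_Suc_I)
qed simp

locale input_network =
  fixes E :: "'c::finite rel"
  assumes regular: "one_input_regular E"
begin

abbreviation \<phi> :: "'c \<Rightarrow> 'c" where
  "\<phi> \<equiv> input E"

lemma edge_iff: "(b, c) \<in> E \<longleftrightarrow> b = \<phi> c"
proof -
  have "\<exists>!b. (b, c) \<in> E"
    using regular by (simp add: one_input_regular_def)
  then show ?thesis
    unfolding input_def by (metis the_equality)
qed

lemma relpow_edge_iff: "(b, c) \<in> E ^^ k \<longleftrightarrow> b = (\<phi> ^^ k) c"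
proof (induction k arbitrary: c)
  case (Suc k)
  have "(b, c) \<in> E ^^ Suc k \<longleftrightarrow> (b, \<phi> c) \<in> E ^^ k"
    by (auto simp: edge_iff)
  then show ?case
    by (simp add: Suc funpow_swap1)
qed simp

lemma in_ring_iff: "c \<in> ring E \<longleftrightarrow> (\<exists>n>0. (\<phi> ^^ n) c = c)"
  unfolding ring_def by (auto simp: trancl_power relpow_edge_iff intro: sym)

lemma input_in_ring: "c \<in> ring E \<Longrightarrow> \<phi> c \<in> ring E"
  unfolding in_ring_iff by (metis funpow_swap1)

lemma funpow_multiple_of_period:
  assumes "(\<phi> ^^ n) c = c"
  shows "(\<phi> ^^ (n * l)) c = c"
proof -
  have "((\<phi> ^^ n) ^^ l) c = c"
    by (induction l) (simp_all add: assms)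
  then show ?thesis
    by (simp add: funpow_mult)
qed

text \<open>
  By finiteness the iterated inputs of a cell repeat, and a repeated cell lies on the ring.
\<close>

lemma reaches_ring: "\<exists>n. (\<phi> ^^ n) c \<in> ring E"
proof -
  have "\<not> inj (\<lambda>i. (\<phi> ^^ i) c)"
    using range_inj_infinite[of "\<lambda>i. (\<phi> ^^ i) c"] by auto
  then obtain i j where ij: "i < j" "(\<phi> ^^ i) c = (\<phi> ^^ j) c"
    unfolding inj_def by (metis linorder_neqE_nat)
  have "(\<phi> ^^ (j - i)) ((\<phi> ^^ i) c) = (\<phi> ^^ (j - i + i)) c"
    by (simp only: funpow_add comp_apply)
  also have "\<dots> = (\<phi> ^^ i) c"
    using ij by simp
  finally show ?thesis
    using ij(1) unfolding in_ring_iff by (metis zero_less_diff)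
qed

text \<open>
  Having an iterated input in common with \<open>p\<close> is passed on along every edge in either direction, so by
  connectedness all cells have it. For ring cells the path to the common
  input can be prolonged around the cycle.
\<close>

lemma ring_single_cycle:
  assumes "p \<in> ring E" "c \<in> ring E"
  shows "\<exists>l. (\<phi> ^^ l) p = c"
proof -
  have "(p, c) \<in> (E \<union> E\<inverse>)\<^sup>*"
    using regular by (simp add: one_input_regular_def)
  then have "\<exists>i j. (\<phi> ^^ i) p = (\<phi> ^^ j) c"
  proof (induction rule: rtrancl_induct)
    case (step y z)
    then obtain i j where ij: "(\<phi> ^^ i) p = (\<phi> ^^ j) y"
      by blast
    from step(2) have "y = \<phi> z \<or> z = \<phi> y"
      by (auto simp: edge_iff)
    then show ?case
    proof
      assume "y = \<phi> z"
      then have "(\<phi> ^^ i) p = (\<phi> ^^ Suc j) z"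
        using ij by (simp add: funpow_swap1)
      then show ?thesis
        by blast
    next
      assume "z = \<phi> y"
      then have "(\<phi> ^^ Suc i) p = (\<phi> ^^ j) z"
        using ij by (simp add: funpow_swap1)
      then show ?thesis
        by blast
    qed
  qed blast
  then obtain i j where ij: "(\<phi> ^^ i) p = (\<phi> ^^ j) c"
    by blast
  obtain n where n: "n > 0" "(\<phi> ^^ n) c = c"
    using assms(2) in_ring_iff by blast
  \<comment> \<open>Going on by \<open>n * j - j\<close> steps completes the \<open>j\<close> steps from \<open>c\<close> to \<open>j\<close> full turns.\<close>
  have "(\<phi> ^^ (n * j - j + i)) p = (\<phi> ^^ (n * j - j)) ((\<phi> ^^ j) c)"
    by (simp only: funpow_add comp_apply ij)
  also have "\<dots> = (\<phi> ^^ (n * j - j + j)) c"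
    by (simp only: funpow_add comp_apply)
  also have "n * j - j + j = n * j"
    using n(1) by simp
  also have "(\<phi> ^^ (n * j)) c = c"
    by (rule funpow_multiple_of_period[OF n(2)])
  finally show ?thesis
    by blast
qed

lemma ring_cycle:
  assumes p: "p \<in> ring E"
  defines "m \<equiv> card (ring E)"
  shows "0 < m" "ring E = (\<lambda>i. (\<phi> ^^ i) p) ` {..<m}"
    "\<And>i j. (\<phi> ^^ i) p = (\<phi> ^^ j) p \<longleftrightarrow> i mod m = j mod m"
proof -
  obtain n where n: "0 < n" "(\<phi> ^^ n) p = (\<phi> ^^ 0) p"
    using p by (auto simp: in_ring_iff)
  obtain k where k: "0 < k" "\<And>i j. (\<phi> ^^ i) p = (\<phi> ^^ j) p \<longleftrightarrow> i mod k = j mod k"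
    by (rule purely_periodic_sequence[of "\<lambda>i. (\<phi> ^^ i) p", OF _ n]) auto
  have ring: "ring E = (\<lambda>i. (\<phi> ^^ i) p) ` {..<k}"
  proof (intro equalityI subsetI)
    fix c assume "c \<in> ring E"
    then obtain l where "c = (\<phi> ^^ l) p"
      using ring_single_cycle[OF p] by metis
    also have "\<dots> = (\<phi> ^^ (l mod k)) p"
      unfolding k(2) by simp
    finally show "c \<in> (\<lambda>i. (\<phi> ^^ i) p) ` {..<k}"
      using k(1) by auto
  next
    fix c assume "c \<in> (\<lambda>i. (\<phi> ^^ i) p) ` {..<k}"
    then obtain i where "c = (\<phi> ^^ i) p"
      by blast
    moreover have "(\<phi> ^^ i) p \<in> ring E" for i
      by (induction i) (simp_all add: p input_in_ring)
    ultimately show "c \<in> ring E"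
      by simp
  qed
  moreover have "inj_on (\<lambda>i. (\<phi> ^^ i) p) {..<k}"
    by (rule inj_onI) (simp add: k(2))
  ultimately have "card (ring E) = k"
    by (simp add: card_image)
  then have "k = m"
    by (simp add: m_def)
  with k(1) show "0 < m"
    by simp
  show "ring E = (\<lambda>i. (\<phi> ^^ i) p) ` {..<m}"
    using ring unfolding \<open>k = m\<close> .
  show "(\<phi> ^^ i) p = (\<phi> ^^ j) p \<longleftrightarrow> i mod m = j mod m" for i j
    using k(2) unfolding \<open>k = m\<close> .
qed

lemma cell_in_some_tree: "\<exists>\<sigma>\<in>ring E. c \<in> tree_cells E \<sigma>"
proof -
  obtain n where "(\<phi> ^^ n) c \<in> ring E"
    using reaches_ring by blast
  then show ?thesis
  proof (induction n arbitrary: c)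
    case 0
    then show ?case
      by (auto simp: tree_cells_def)
  next
    case (Suc n)
    show ?case
    proof (cases "c \<in> ring E")
      case True
      then show ?thesis
        by (auto simp: tree_cells_def)
    next
      case False
      from Suc obtain \<sigma> where "\<sigma> \<in> ring E" "(\<sigma>, \<phi> c) \<in> (tree_edges E)\<^sup>*"
        by (auto simp: tree_cells_def funpow_swap1)
      moreover have "(\<phi> c, c) \<in> tree_edges E"
        using False by (simp add: tree_edges_def ring_edges_def edge_iff)
      ultimately show ?thesis
        unfolding tree_cells_def by (auto intro: rtrancl_into_rtrancl)
    qed
  qed
qed

text \<open>
  A cell and the ring cell under it are at the same distance from a common ancestor, namely the root of
  the tree, and distance \<open>k\<close> from an ancestor means reaching it by \<open>k\<close> applications of \<open>\<phi>\<close>.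
\<close>

lemma overlapping_same_ancestor:
  assumes "overlapping E b c"
  shows "\<exists>k l p. (\<phi> ^^ k) b = (\<phi> ^^ k) p \<and> (\<phi> ^^ l) c = (\<phi> ^^ l) p"
proof -
  have laid: "\<exists>k. (\<phi> ^^ k) b = (\<phi> ^^ k) p" if "laid_over E b p" for b p
  proof -
    from that obtain \<rho> k where \<rho>: "(\<rho>, b) \<in> tree_edges E ^^ k" "(\<rho>, p) \<in> ring_edges E ^^ k"
      unfolding laid_over_def by blast
    have sub: "tree_edges E \<subseteq> E" "ring_edges E \<subseteq> E"
      by (auto simp: tree_edges_def ring_edges_def)
    have "(\<rho>, b) \<in> E ^^ k" "(\<rho>, p) \<in> E ^^ k"
      by (rule relpow_mono[OF sub(1) \<rho>(1)], rule relpow_mono[OF sub(2) \<rho>(2)])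
    then show ?thesis
      by (auto simp: relpow_edge_iff)
  qed
  then show ?thesis
    using assms unfolding overlapping_def by metis
qed

end

section \<open>Colours along the ring\<close>

locale coloured_network = input_network E for E :: "'c::finite rel" +
  fixes \<kappa> :: "'c \<Rightarrow> 'k"
  assumes balanced: "balanced E \<kappa>"
begin

lemma colour_funpow: "\<kappa> c = \<kappa> d \<Longrightarrow> \<kappa> ((\<phi> ^^ l) c) = \<kappa> ((\<phi> ^^ l) d)"
proof (induction l)
  case (Suc l)
  then show ?case
    using balancedD[OF balanced, of "(\<phi> ^^ l) c" "(\<phi> ^^ l) d"] by simp
qed simp

text \<open>
  On the ring \<open>\<phi>\<close> is invertible by an iterate of itself, and a common multiple of the return times of two
  ring cells provides one exponent that inverts it at both. Iterates respect colours.
\<close>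

lemma input_injective_on_ring_colours:
  assumes "c \<in> ring E" "d \<in> ring E" "\<kappa> (\<phi> c) = \<kappa> (\<phi> d)"
  shows "\<kappa> c = \<kappa> d"
proof -
  obtain n where n: "n > 0" "(\<phi> ^^ n) c = c"
    using assms(1) in_ring_iff by blast
  obtain l where l: "l > 0" "(\<phi> ^^ l) d = d"
    using assms(2) in_ring_iff by blast
  obtain N where N: "n * l = Suc N"
    using n(1) l(1) by (metis gr0_implies_Suc nat_0_less_mult_iff)
  have "(\<phi> ^^ N) (\<phi> c) = c"
    using funpow_multiple_of_period[OF n(2), of l] by (simp add: N funpow_swap1)
  moreover have "(\<phi> ^^ N) (\<phi> d) = d"
    using funpow_multiple_of_period[OF l(2), of n] by (simp add: N mult.commute[of l] funpow_swap1)
  ultimately show ?thesis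
    using colour_funpow[OF assms(3), of N] by simp
qed

text \<open>
  Both the cells \<open>\<phi>\<^sup>i p\<close> and their colours are purely periodic, with periods \<open>m\<close> and some \<open>k\<close>
  dividing \<open>m\<close>. Since \<open>\<phi>\<close> runs against the edges, the listing in the order of the edges has \<open>\<phi>\<^sup>i p\<close> at
  position \<open>m - 1 - i\<close>; reflection does not affect periodicity.
\<close>

lemma ring_colour_sequence:
  obtains k ps cs where "k dvd card (ring E)" "ring_listing E ps" "length cs = k" "distinct cs"
    "map \<kappa> ps = concat (replicate (card (ring E) div k) cs)"
proof -
  define m where "m = card (ring E)"
  obtain p where p: "p \<in> ring E"
    using reaches_ring by blast
  note cycle = ring_cycle[OF p, folded m_def]
  have "(\<phi> ^^ m) p = (\<phi> ^^ 0) p"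
    unfolding cycle(3) by simp
  then have "\<kappa> ((\<phi> ^^ m) p) = \<kappa> ((\<phi> ^^ 0) p)"
    by simp
  moreover have "\<kappa> ((\<phi> ^^ Suc i) p) = \<kappa> ((\<phi> ^^ Suc j) p)" if "\<kappa> ((\<phi> ^^ i) p) = \<kappa> ((\<phi> ^^ j) p)"
    for i j
    using balancedD[OF balanced that] by simp
  ultimately obtain k where k: "0 < k" "k dvd m"
    "\<And>i j. \<kappa> ((\<phi> ^^ i) p) = \<kappa> ((\<phi> ^^ j) p) \<longleftrightarrow> i mod k = j mod k"
    using purely_periodic_sequence[of "\<lambda>i. \<kappa> ((\<phi> ^^ i) p)", OF _ cycle(1)] by metis
  have "k \<le> m"
    using k(2) cycle(1) by (rule dvd_imp_le)
  have reflect: "inj_on (\<lambda>j. (m - 1 - j) mod l) {0..<l}" if "l \<le> m" for l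
  proof (rule inj_onI)
    fix i j assume ij: "i \<in> {0..<l}" "j \<in> {0..<l}" "(m - 1 - i) mod l = (m - 1 - j) mod l"
    have *: "\<not> (m - 1 - i) mod l = (m - 1 - j) mod l" if "i < j" "j < l" for i j
    proof
      assume "(m - 1 - i) mod l = (m - 1 - j) mod l"
      then have "l dvd (m - 1 - i) - (m - 1 - j)"
        by (rule mod_eq_dvd_iff_nat[THEN iffD1, rotated]) (use that in simp)
      moreover have "(m - 1 - i) - (m - 1 - j) = j - i"
        using that \<open>l \<le> m\<close> by simp
      ultimately show False
        using that by (auto dest!: dvd_imp_le)
    qed
    show "i = j"
      using *[of i j] *[of j i] ij by (metis atLeastLessThan_iff linorder_neqE_nat)
  qed
  define ps where "ps = map (\<lambda>j. (\<phi> ^^ (m - 1 - j)) p) [0..<m]"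
  define g where "g j = \<kappa> ((\<phi> ^^ (m - 1 - j)) p)" for j
  have listing: "ring_listing E ps"
    unfolding ring_listing_def
  proof (intro conjI allI impI)
    have "inj_on (\<lambda>j. (\<phi> ^^ (m - 1 - j)) p) {0..<m}"
      using reflect[of m] by (simp add: inj_on_def cycle(3))
    then show "distinct ps"
      by (simp add: ps_def distinct_map)
    have "i \<in> (\<lambda>j. m - 1 - j) ` {0..<m}" if "i < m" for i
      using that by (intro image_eqI[of _ _ "m - 1 - i"]) auto
    then have "(\<lambda>j. m - 1 - j) ` {0..<m} = {..<m}"
      using cycle(1) by auto
    moreover have "(\<lambda>j. (\<phi> ^^ (m - 1 - j)) p) ` {0..<m}
        = (\<lambda>i. (\<phi> ^^ i) p) ` (\<lambda>j. m - 1 - j) ` {0..<m}"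
      by (simp only: image_image)
    ultimately have "(\<lambda>j. (\<phi> ^^ (m - 1 - j)) p) ` {0..<m} = (\<lambda>i. (\<phi> ^^ i) p) ` {..<m}"
      by simp
    then show "set ps = ring E"
      by (simp add: ps_def cycle(2))
  next
    fix j assume "j < length ps"
    then have j: "j < m"
      by (simp add: ps_def)
    have "ps ! j = \<phi> (ps ! (Suc j mod m))"
    proof (cases "Suc j = m")
      case True
      have "\<phi> ((\<phi> ^^ (m - 1)) p) = (\<phi> ^^ m) p"
        using cycle(1) by (metis Suc_pred' comp_apply funpow.simps(2))
      then show ?thesis
        using True j \<open>(\<phi> ^^ m) p = (\<phi> ^^ 0) p\<close> by (auto simp: ps_def)
    next
      case False
      then have "m - 1 - j = Suc (m - 1 - Suc j)"
        using j by simp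
      then show ?thesis
        using False j by (simp add: ps_def)
    qed
    then show "(ps ! j, ps ! (Suc j mod length ps)) \<in> E"
      by (simp add: edge_iff ps_def)
  qed
  have "inj_on g {0..<k}"
  proof (rule inj_onI)
    fix i j assume ij: "i \<in> {0..<k}" "j \<in> {0..<k}" "g i = g j"
    then have "(m - 1 - i) mod k = (m - 1 - j) mod k"
      by (simp add: g_def k(3))
    then show "i = j"
      using ij(1,2) by (rule inj_onD[OF reflect[OF \<open>k \<le> m\<close>]])
  qed
  then have distinct: "distinct (map g [0..<k])"
    by (simp add: distinct_map)
  have "g j = g (j mod k)" if "j < m div k * k" for j
  proof -
    have "m - 1 - j mod k = (m - 1 - j) + k * (j div k)"
    proof -
      have "j < m"
        using that k(2) by simp
      then show ?thesis
        using mod_mult_div_eq[of j k] by linarith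
    qed
    then show ?thesis
      by (simp add: g_def k(3))
  qed
  then have "map g [0..<m div k * k] = concat (replicate (m div k) (map g [0..<k]))"
    by (rule map_upt_eq_concat_replicate)
  moreover have "map \<kappa> ps = map g [0..<m]"
    by (simp add: ps_def g_def)
  ultimately have "map \<kappa> ps = concat (replicate (m div k) (map g [0..<k]))"
    using k(2) by simp
  with listing distinct show thesis
    using that[of k ps "map g [0..<k]"] k(2) by (simp add: m_def)
qed

text \<open>
  The case of an injective map on colours. Equal colours can be pulled back along inputs, which gives
  the overlapping condition at once; the minimal period of the ring colours distinguishes the cases. When it is 1,
  pulling back from the ring shows that the trees have the colour of the ring too.
\<close>

lemma periodic_colouring_cases:
  assumes separates: "\<And>c d. \<kappa> (\<phi> c) = \<kappa> (\<phi> d) \<Longrightarrow> \<kappa> c = \<kappa> d"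
  shows "(\<forall>c d. \<kappa> c = \<kappa> d)
   \<or> ((\<exists>d. d dvd card (ring E) \<and> d \<noteq> card (ring E) \<and> d \<noteq> 1 \<and>
         (\<exists>ps cs. ring_listing E ps \<and> length cs = card (ring E) div d \<and> distinct cs \<and>
            map \<kappa> ps = concat (replicate d cs))) \<and>
      (\<forall>b c. overlapping E b c \<longrightarrow> \<kappa> b = \<kappa> c))
   \<or> (inj_on \<kappa> (ring E) \<and>
      (\<forall>b c. overlapping E b c \<longrightarrow> \<kappa> b = \<kappa> c))"
proof -
  have pull_back: "\<kappa> c = \<kappa> d" if "\<kappa> ((\<phi> ^^ l) c) = \<kappa> ((\<phi> ^^ l) d)" for l c d
    using that by (induction l) (auto dest: separates)
  have overlap: "\<forall>b c. overlapping E b c \<longrightarrow> \<kappa> b = \<kappa> c"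
    using overlapping_same_ancestor pull_back by metis
  define m where "m = card (ring E)"
  obtain p where p: "p \<in> ring E"
    using reaches_ring by blast
  have "0 < m"
    using ring_cycle(1)[OF p] by (simp add: m_def)
  obtain k ps cs where k: "k dvd m" and ps: "ring_listing E ps" and cs: "length cs = k" "distinct cs"
    and colours: "map \<kappa> ps = concat (replicate (m div k) cs)"
    using ring_colour_sequence unfolding m_def by blast
  have "0 < k"
    using k \<open>0 < m\<close> by (rule dvd_pos_nat[rotated])
  have set_ps: "set ps = ring E"
    using ps by (simp add: ring_listing_def)
  consider "k = 1" | "k = m" | "k \<noteq> 1" "k \<noteq> m"
    by blast
  then show ?thesis
  proof cases
    case 1
    then obtain r where "cs = [r]"
      using cs(1) by (auto simp: length_Suc_conv)
    then have "\<kappa> ` ring E \<subseteq> {r}"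
      using arg_cong[OF colours, of set] set_ps by auto
    then have ring_r: "\<kappa> c = r" if "c \<in> ring E" for c
      using that by blast
    have "\<kappa> c = r" for c
    proof -
      obtain n where n: "(\<phi> ^^ n) c \<in> ring E"
        using reaches_ring by blast
      have "(\<phi> ^^ n) p \<in> ring E"
        by (induction n) (simp_all add: p input_in_ring)
      then show ?thesis
        using pull_back[of n c p] ring_r n p by simp
    qed
    then show ?thesis
      by simp
  next
    case 2
    then have "map \<kappa> ps = cs"
      using colours \<open>0 < m\<close> by simp
    then have "inj_on \<kappa> (ring E)"
      using cs(2) set_ps distinct_map by metis
    with overlap show ?thesis
      by blast
  next
    case 3
    define d where "d = m div k"
    have m_eq: "m = d * k"
      using k by (simp add: d_def)
    then have "0 < d"
      using \<open>0 < m\<close> by simp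
    then have "d dvd m" "d \<noteq> m" "d \<noteq> 1" "length cs = m div d"
      using 3 m_eq cs(1) by auto
    then show ?thesis
      using overlap ps cs(2) colours unfolding d_def[symmetric] m_def[symmetric] by blast
  qed
qed

text \<open>
  With two colours on the ring, painting the whole ring in one colour would be a second proper balanced
  coarsening. By the criterion it must touch both colours of the mergeable pair, so both occur on the ring,
  where the map on colours is injective.
\<close>

lemma ring_monochromatic:
  assumes irr: "join_irreducible E (sync_space (same_colour \<kappa>))"
    and ab: "\<kappa> a \<noteq> \<kappa> b" "\<kappa> (\<phi> a) = \<kappa> (\<phi> b)"
    and "c \<in> ring E" "d \<in> ring E"
  shows "\<kappa> c = \<kappa> d"
proof (rule ccontr)
  assume neq: "\<kappa> c \<noteq> \<kappa> d"
  define P where "P = \<kappa> ` ring E"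
  have cd_P: "\<kappa> c \<in> P" "\<kappa> d \<in> P"
    using assms(4,5) by (simp_all add: P_def)
  define \<mu> where "\<mu> e = (if \<kappa> e \<in> P then \<kappa> c else \<kappa> e)" for e
  have \<mu>_eq: "\<mu> e = \<mu> e' \<longleftrightarrow> \<kappa> e = \<kappa> e' \<or> \<kappa> e \<in> P \<and> \<kappa> e' \<in> P" for e e'
    using cd_P(1) by (auto simp: \<mu>_def)
  have input_P: "\<kappa> (\<phi> e) \<in> P" if "\<kappa> e \<in> P" for e
  proof -
    from that obtain e' where "e' \<in> ring E" "\<kappa> e = \<kappa> e'"
      unfolding P_def by blast
    then show ?thesis
      unfolding P_def using balancedD[OF balanced, of e e'] input_in_ring[of e'] by simp
  qed
  have "balanced E \<mu>"
    unfolding balanced_def \<mu>_eq using input_P balancedD[OF balanced] by blast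
  moreover have "\<mu> e = \<mu> e'" if "\<kappa> e = \<kappa> e'" for e e'
    using that by (simp add: \<mu>_def)
  moreover have "\<mu> c = \<mu> d"
    using cd_P by (simp add: \<mu>_eq)
  then have "\<exists>e e'. \<kappa> e \<noteq> \<kappa> e' \<and> \<mu> e = \<mu> e'"
    using neq by blast
  ultimately have "\<exists>e. \<mu> e = \<mu> a' \<and> \<kappa> e \<noteq> \<kappa> a'"
    if "\<kappa> a' \<noteq> \<kappa> b'" "\<kappa> (\<phi> a') = \<kappa> (\<phi> b')" for a' b'
    by (rule no_independent_merging[OF balanced irr that])
  then have in_P: "\<kappa> a' \<in> P" if "\<kappa> a' \<noteq> \<kappa> b'" "\<kappa> (\<phi> a') = \<kappa> (\<phi> b')" for a' b'
    using that \<mu>_eq[of _ a'] by metis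
  have "\<kappa> a \<in> P"
    using ab by (rule in_P)
  moreover have "\<kappa> b \<in> P"
    using ab[symmetric] by (rule in_P)
  ultimately obtain a' b' where ab': "a' \<in> ring E" "\<kappa> a = \<kappa> a'" "b' \<in> ring E" "\<kappa> b = \<kappa> b'"
    unfolding P_def by blast
  have "\<kappa> (\<phi> a') = \<kappa> (\<phi> b')"
    using balancedD[OF balanced ab'(2)] balancedD[OF balanced ab'(4)] ab(2) by simp
  then show False
    using input_injective_on_ring_colours ab' ab(1) by metis
qed

end

section \<open>Colourings with a one-coloured ring\<close>

text \<open>
  The second assumption says that the map on colours is injective away from \<open>r\<close>. It is the form in which
  uniqueness of the mergeable pair is used once the pair is known to contain \<open>r\<close>.
\<close>

locale levelled_network = coloured_network E \<kappa> for E :: "'c::finite rel" and \<kappa> :: "'c \<Rightarrow> 'k" +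
  fixes r :: 'k
  assumes ring_colour: "c \<in> ring E \<Longrightarrow> \<kappa> c = r"
    and separates: "\<kappa> (\<phi> c) = \<kappa> (\<phi> d) \<Longrightarrow> \<kappa> c \<noteq> r \<Longrightarrow> \<kappa> d \<noteq> r \<Longrightarrow> \<kappa> c = \<kappa> d"
begin

definition level :: "'c \<Rightarrow> nat" where
  "level c = (LEAST j. \<kappa> ((\<phi> ^^ j) c) = r)"

lemma colour_at_level: "\<kappa> ((\<phi> ^^ level c) c) = r"
proof -
  obtain n where "(\<phi> ^^ n) c \<in> ring E"
    using reaches_ring by blast
  then have "\<kappa> ((\<phi> ^^ n) c) = r"
    by (rule ring_colour)
  then show ?thesis
    unfolding level_def by (rule LeastI[of "\<lambda>j. \<kappa> ((\<phi> ^^ j) c) = r"])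
qed

lemma level_eq_0_iff: "level c = 0 \<longleftrightarrow> \<kappa> c = r"
proof
  assume "level c = 0"
  then show "\<kappa> c = r"
    using colour_at_level[of c] by simp
next
  assume "\<kappa> c = r"
  then show "level c = 0"
    unfolding level_def by (intro Least_eq_0) simp
qed

lemma level_Suc:
  assumes "\<kappa> c \<noteq> r"
  shows "level c = Suc (level (\<phi> c))"
proof -
  have "level c = Suc (LEAST j. \<kappa> ((\<phi> ^^ Suc j) c) = r)"
    unfolding level_def by (rule Least_Suc[of _ "level c"]) (use colour_at_level assms in simp_all)
  then show ?thesis
    by (simp add: level_def funpow_swap1)
qed

lemma input_colour_r:
  assumes "\<kappa> c = r"
  shows "\<kappa> (\<phi> c) = r"
proof -
  obtain p where p: "p \<in> ring E"
    using reaches_ring by blast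
  have "\<kappa> c = \<kappa> p"
    using assms ring_colour[OF p] by simp
  then have "\<kappa> (\<phi> c) = \<kappa> (\<phi> p)"
    by (rule balancedD[OF balanced])
  then show ?thesis
    using ring_colour[OF input_in_ring[OF p]] by simp
qed

text \<open>
  Colours are levels: by induction, cells of equal level have inputs of equal colour, and away from \<open>r\<close>
  the colour of the input determines that of the cell.
\<close>

lemma level_eq_iff: "level c = level d \<longleftrightarrow> \<kappa> c = \<kappa> d"
proof
  assume "level c = level d"
  then show "\<kappa> c = \<kappa> d"
  proof (induction "level c" arbitrary: c d)
    case 0
    then have "level c = 0" "level d = 0"
      by simp_all
    then show ?case
      by (simp add: level_eq_0_iff)
  next
    case (Suc n)
    have cd: "\<kappa> c \<noteq> r" "\<kappa> d \<noteq> r"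
      using Suc(2,3) level_eq_0_iff[of c] level_eq_0_iff[of d] by auto
    have "n = level (\<phi> c)" "level (\<phi> c) = level (\<phi> d)"
      using Suc(2,3) level_Suc[OF cd(1)] level_Suc[OF cd(2)] by simp_all
    then have "\<kappa> (\<phi> c) = \<kappa> (\<phi> d)"
      by (rule Suc(1))
    then show ?case
      using cd by (rule separates)
  qed
next
  assume "\<kappa> c = \<kappa> d"
  then have "\<kappa> ((\<phi> ^^ j) c) = \<kappa> ((\<phi> ^^ j) d)" for j
    by (rule colour_funpow)
  then show "level c = level d"
    by (simp add: level_def)
qed

text \<open>
  The branch at \<open>\<rho>\<close> gathers the cells whose chain of inputs first meets colour \<open>r\<close> at \<open>\<rho>\<close>. The root is
  included although it has colour \<open>r\<close>: starting from a cell of level 1 would make the depth one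
  less, too small for the fifth alternative when the highest level is 2.
\<close>

definition branch :: "'c \<Rightarrow> 'c set" where
  "branch \<rho> = {c. (\<phi> ^^ level c) c = \<rho>}"

lemma root_in_branch: "\<kappa> \<rho> = r \<Longrightarrow> \<rho> \<in> branch \<rho>"
  by (simp add: branch_def level_eq_0_iff[THEN iffD2])

lemma input_in_branch:
  assumes "c \<in> branch \<rho>" "\<kappa> c \<noteq> r"
  shows "\<phi> c \<in> branch \<rho>"
  using assms by (simp add: branch_def level_Suc funpow_swap1)

lemma edge_in_branch:
  assumes "c \<in> branch \<rho>" "\<kappa> c \<noteq> r"
  shows "(\<phi> c, c) \<in> edges_in E (branch \<rho>)"
proof -
  have "c \<notin> ring E"
    using assms(2) ring_colour by blast
  then show ?thesis
    using assms input_in_branch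
    by (simp add: edges_in_def tree_edges_def ring_edges_def edge_iff)
qed

text \<open>
  The danger is an edge between two cells of colour \<open>r\<close>. Both would be the root, so the edge would be a
  self-loop, which belongs to the ring and not to a tree.
\<close>

lemma level_edge_in_branch:
  assumes "(b, c) \<in> edges_in E (branch \<rho>)"
  shows "level c = Suc (level b)"
proof -
  have b: "b = \<phi> c" "b \<in> branch \<rho>" "c \<in> branch \<rho>" and not_ring: "(b, c) \<notin> ring_edges E"
    using assms by (auto simp: edges_in_def tree_edges_def edge_iff)
  have "\<kappa> c \<noteq> r"
  proof
    assume c: "\<kappa> c = r"
    then have "\<kappa> b = r"
      using b(1) input_colour_r by simp
    with c b(2,3) have "c = \<rho>" "b = \<rho>"
      by (simp_all add: branch_def level_eq_0_iff[THEN iffD2])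
    then have "(\<phi> ^^ 1) c = c"
      using b(1) by simp
    then have "c \<in> ring E"
      unfolding in_ring_iff by (intro exI[of _ 1]) simp
    then show False
      using not_ring b(1) \<open>c = \<rho>\<close> \<open>b = \<rho>\<close> by (simp add: ring_edges_def edge_iff)
  qed
  then show ?thesis
    using b(1) level_Suc by simp
qed

lemma level_path_in_branch:
  assumes "(b, c) \<in> edges_in E (branch \<rho>) ^^ k"
  shows "level c = level b + k"
  using assms
proof (induction k arbitrary: c)
  case (Suc k)
  from Suc.prems obtain y where "(b, y) \<in> edges_in E (branch \<rho>) ^^ k" "(y, c) \<in> edges_in E (branch \<rho>)"
    by (rule relpow_Suc_E)
  then show ?case
    using Suc.IH level_edge_in_branch by simp
qed simp

lemma path_from_root:
  assumes "c \<in> branch \<rho>"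
  shows "(\<rho>, c) \<in> edges_in E (branch \<rho>) ^^ level c"
  using assms
proof (induction "level c" arbitrary: c)
  case 0
  then show ?case
    by (simp add: branch_def)
next
  case (Suc n)
  have c: "\<kappa> c \<noteq> r"
    using Suc(2) level_eq_0_iff[of c] by simp
  have n: "n = level (\<phi> c)"
    using Suc(2) level_Suc[OF c] by simp
  have "(\<rho>, \<phi> c) \<in> edges_in E (branch \<rho>) ^^ level (\<phi> c)"
    using n input_in_branch[OF Suc(3) c] by (rule Suc(1))
  then have "(\<rho>, c) \<in> edges_in E (branch \<rho>) ^^ Suc (level (\<phi> c))"
    using edge_in_branch[OF Suc(3) c] by (rule relpow_Suc_I)
  then show ?case
    by (simp add: level_Suc[OF c])
qed

lemma subtree_root_branch:
  assumes "\<kappa> \<rho> = r"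
  shows "subtree_root E (branch \<rho>) = \<rho>"
  unfolding subtree_root_def
proof (rule the_equality)
  show "\<rho> \<in> branch \<rho> \<and> (\<forall>c\<in>branch \<rho>. (\<rho>, c) \<in> (edges_in E (branch \<rho>))\<^sup>*)"
    using root_in_branch[OF assms] path_from_root by (blast intro: relpow_imp_rtrancl)
next
  fix \<sigma> assume \<sigma>: "\<sigma> \<in> branch \<rho> \<and> (\<forall>c\<in>branch \<rho>. (\<sigma>, c) \<in> (edges_in E (branch \<rho>))\<^sup>*)"
  then obtain k where "(\<sigma>, \<rho>) \<in> edges_in E (branch \<rho>) ^^ k"
    using root_in_branch[OF assms] rtrancl_imp_relpow by blast
  then have "level \<rho> = level \<sigma> + k"
    by (rule level_path_in_branch)
  then have "level \<sigma> = 0"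
    using assms level_eq_0_iff[of \<rho>] by simp
  then show "\<sigma> = \<rho>"
    using \<sigma> by (simp add: branch_def)
qed

lemma root_dist_branch:
  assumes "\<kappa> \<rho> = r" "c \<in> branch \<rho>"
  shows "root_dist E (branch \<rho>) c = level c"
  unfolding root_dist_def subtree_root_branch[OF assms(1)]
proof (rule the_equality)
  show "(\<rho>, c) \<in> edges_in E (branch \<rho>) ^^ level c"
    using assms(2) by (rule path_from_root)
next
  fix k assume "(\<rho>, c) \<in> edges_in E (branch \<rho>) ^^ k"
  then have "level c = level \<rho> + k"
    by (rule level_path_in_branch)
  then show "k = level c"
    using assms(1) level_eq_0_iff[of \<rho>] by simp
qed

lemma subtree_branch:
  assumes "\<kappa> \<rho> = r"
  shows "subtree E (branch \<rho>)"
  unfolding subtree_def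
proof (intro conjI ballI)
  show "branch \<rho> \<noteq> {}"
    using root_in_branch[OF assms] by blast
next
  let ?D = "edges_in E (branch \<rho>)"
  have from_root: "(\<rho>, c) \<in> ?D\<^sup>*" if "c \<in> branch \<rho>" for c
    using path_from_root[OF that] by (rule relpow_imp_rtrancl)
  show "\<exists>\<sigma>\<in>ring E. branch \<rho> \<subseteq> tree_cells E \<sigma>"
  proof -
    obtain \<sigma> where \<sigma>: "\<sigma> \<in> ring E" "(\<sigma>, \<rho>) \<in> (tree_edges E)\<^sup>*"
      using cell_in_some_tree by (auto simp: tree_cells_def)
    have "?D\<^sup>* \<subseteq> (tree_edges E)\<^sup>*"
      by (rule rtrancl_mono) (auto simp: edges_in_def)
    then have "branch \<rho> \<subseteq> tree_cells E \<sigma>"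
      using from_root rtrancl_trans[OF \<sigma>(2)] unfolding tree_cells_def by blast
    with \<sigma>(1) show ?thesis
      by blast
  qed
  fix b c assume "b \<in> branch \<rho>" "c \<in> branch \<rho>"
  then have "(b, \<rho>) \<in> (?D\<inverse>)\<^sup>*" "(\<rho>, c) \<in> ?D\<^sup>*"
    using from_root by (simp_all add: rtrancl_converse)
  then have "(b, \<rho>) \<in> (?D \<union> ?D\<inverse>)\<^sup>*" "(\<rho>, c) \<in> (?D \<union> ?D\<inverse>)\<^sup>*"
    using rtrancl_mono[of "?D\<inverse>" "?D \<union> ?D\<inverse>"] rtrancl_mono[of ?D "?D \<union> ?D\<inverse>"] by auto
  then show "(b, c) \<in> (?D \<union> ?D\<inverse>)\<^sup>*"
    by (rule rtrancl_trans)
qed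

text \<open>
  Levels increase along the edges of a branch, so a cell of maximal level is a leaf of the branch.
\<close>

lemma level_le_depth_branch:
  assumes "\<kappa> \<rho> = r" "c \<in> branch \<rho>"
  shows "level c \<le> depth E (branch \<rho>)"
proof -
  have "finite (level ` branch \<rho>)" "level ` branch \<rho> \<noteq> {}"
    using assms(2) by auto
  then obtain e where e: "e \<in> branch \<rho>" "level e = Max (level ` branch \<rho>)"
    using Max_in by (metis imageE)
  have e_max: "level b \<le> level e" if "b \<in> branch \<rho>" for b
    unfolding e(2) using that by (intro Max_ge) auto
  have "(e, b) \<notin> edges_in E (branch \<rho>)" for b
  proof
    assume eb: "(e, b) \<in> edges_in E (branch \<rho>)"
    then have "b \<in> branch \<rho>"
      by (simp add: edges_in_def)
    then show False
      using level_edge_in_branch[OF eb] e_max[of b] by simp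
  qed
  then have leaf: "e \<in> subtree_leaves E (branch \<rho>)"
    using e(1) by (simp add: subtree_leaves_def)
  then have "depth E (branch \<rho>) = Max (root_dist E (branch \<rho>) ` subtree_leaves E (branch \<rho>))"
    by (auto simp: depth_def)
  moreover have "root_dist E (branch \<rho>) e \<le> \<dots>"
    using leaf by (intro Max_ge) auto
  ultimately show ?thesis
    using root_dist_branch[OF assms(1) e(1)] e_max[OF assms(2)] by simp
qed

text \<open>
  If no level exceeds 1, a cell of level 1 feeds nothing, as its successors would have level 2. Otherwise
  the branches containing a cell of colour other than \<open>r\<close> are the subtrees sought: distance from the root is level, which is
  equivalent to colour across all branches, and a cell of level at least 2 bounds the depth from below.
\<close>

lemma levelled_colouring_cases:
  assumes "\<exists>c. \<kappa> c \<noteq> r"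
  shows "(\<exists>L r r'. L \<noteq> {} \<and> L \<subseteq> leaves E \<and> r \<noteq> r' \<and>
        (\<forall>c. c \<notin> L \<longrightarrow> \<kappa> c = r) \<and> (\<forall>c\<in>L. \<kappa> c = r'))
   \<or> (\<exists>J r. J \<noteq> {} \<and> (\<forall>B\<in>J. subtree E B) \<and> Max (depth E ` J) > 1 \<and>
        (\<forall>c. c \<notin> \<Union>J \<longrightarrow> \<kappa> c = r) \<and>
        (\<forall>B\<in>J. \<forall>c\<in>B. \<forall>d\<in>B.
            (root_dist E B c \<noteq> root_dist E B d \<longrightarrow> \<kappa> c \<noteq> \<kappa> d) \<and>
            (root_dist E B c = root_dist E B d \<longrightarrow> \<kappa> c = \<kappa> d)) \<and>
        (\<forall>B\<in>J. \<forall>B'\<in>J. \<forall>c\<in>B. \<forall>d\<in>B'.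
            root_dist E B c = root_dist E B' d \<longrightarrow> \<kappa> c = \<kappa> d))"
proof (cases "\<forall>c. level c \<le> 1")
  case True
  define L where "L = {c. \<kappa> c \<noteq> r}"
  obtain e where e: "\<kappa> e \<noteq> r"
    using assms by blast
  have level_L: "level c = 1" if "c \<in> L" for c
  proof -
    have "level c \<noteq> 0" "level c \<le> 1"
      using that True level_eq_0_iff[of c] by (auto simp: L_def)
    then show ?thesis
      by simp
  qed
  have "L \<noteq> {}"
    using e by (auto simp: L_def)
  moreover have "L \<subseteq> leaves E"
  proof
    fix c assume c: "c \<in> L"
    have "(c, d) \<notin> E" for d
    proof
      assume "(c, d) \<in> E"
      then have cd: "c = \<phi> d"
        by (simp add: edge_iff)
      then have "\<kappa> d \<noteq> r"
        using c input_colour_r[of d] by (auto simp: L_def)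
      then have "level d = Suc (level c)"
        using cd level_Suc by simp
      then have "level d = 2"
        using level_L[OF c] by simp
      moreover have "level d \<le> 1"
        using True by blast
      ultimately show False
        by simp
    qed
    then show "c \<in> leaves E"
      by (simp add: leaves_def)
  qed
  moreover have "\<forall>c. c \<notin> L \<longrightarrow> \<kappa> c = r"
    by (simp add: L_def)
  moreover have "\<kappa> c = \<kappa> e" if "c \<in> L" for c
  proof -
    have "e \<in> L"
      using e by (simp add: L_def)
    then have "level c = level e"
      using level_L that by simp
    then show ?thesis
      by (simp add: level_eq_iff)
  qed
  ultimately show ?thesis
    using e by (intro disjI1 exI[of _ L] exI[of _ r] exI[of _ "\<kappa> e"]) auto
next
  case False
  then obtain e where e: "level e > 1"
    by (auto simp: not_le)
  define top where "top c = (\<phi> ^^ level c) c" for c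
  define J where "J = {branch (top c) | c. \<kappa> c \<noteq> r}"
  have in_branch_top: "c \<in> branch (top c)" for c
    by (simp add: branch_def top_def)
  have J: "\<exists>\<rho>. \<kappa> \<rho> = r \<and> B = branch \<rho>" if "B \<in> J" for B
    using that colour_at_level by (auto simp: J_def top_def)
  have dist: "root_dist E B c = level c" if B: "B \<in> J" "c \<in> B" for B c
  proof -
    obtain \<rho> where "\<kappa> \<rho> = r" "B = branch \<rho>"
      using J[OF B(1)] by blast
    then show ?thesis
      using B(2) root_dist_branch by simp
  qed
  have "\<kappa> e \<noteq> r"
    using e level_eq_0_iff[of e] by auto
  then have e_J: "branch (top e) \<in> J"
    by (auto simp: J_def)
  then have "J \<noteq> {}"
    by blast
  moreover have "\<forall>B\<in>J. subtree E B"
  proof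
    fix B assume "B \<in> J"
    then obtain \<rho> where "\<kappa> \<rho> = r" "B = branch \<rho>"
      using J by blast
    then show "subtree E B"
      using subtree_branch by simp
  qed
  moreover have "1 < Max (depth E ` J)"
  proof -
    note e
    also have "level e \<le> depth E (branch (top e))"
      by (rule level_le_depth_branch[OF _ in_branch_top]) (simp add: top_def colour_at_level)
    also have "\<dots> \<le> Max (depth E ` J)"
      using e_J by (intro Max_ge) auto
    finally show ?thesis .
  qed
  moreover have "\<forall>c. c \<notin> \<Union>J \<longrightarrow> \<kappa> c = r"
    using in_branch_top unfolding J_def by blast
  moreover have "\<kappa> c \<noteq> \<kappa> d" if "B \<in> J" "c \<in> B" "d \<in> B" "root_dist E B c \<noteq> root_dist E B d" for B c d
    using that dist level_eq_iff[of c d] by simp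
  moreover have "\<kappa> c = \<kappa> d"
    if "B \<in> J" "B' \<in> J" "c \<in> B" "d \<in> B'" "root_dist E B c = root_dist E B' d" for B B' c d
    using that dist level_eq_iff[of c d] by simp
  ultimately show ?thesis
    by (intro disjI2 exI[of _ J] exI[of _ r] conjI) blast+
qed

end

theorem corollary4p6:
  fixes E :: "'c::finite rel" and \<kappa> :: "'c \<Rightarrow> 'k" and n m :: nat
  assumes "one_input_regular E"
    and "CARD('c) = n" and "card (ring E) = m" and "1 \<le> m" and "m \<le> n"
    and "balanced E \<kappa>"
    and "join_irreducible E (sync_space (same_colour \<kappa>))"
  shows
    "(\<forall>c d. \<kappa> c = \<kappa> d)
   \<or> ((\<exists>d. d dvd m \<and> d \<noteq> m \<and> d \<noteq> 1 \<and>
         (\<exists>ps cs. ring_listing E ps \<and> length cs = m div d \<and> distinct cs \<and>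
            map \<kappa> ps = concat (replicate d cs))) \<and>
      (\<forall>b c. overlapping E b c \<longrightarrow> \<kappa> b = \<kappa> c))
   \<or> (inj_on \<kappa> (ring E) \<and>
      (\<forall>b c. overlapping E b c \<longrightarrow> \<kappa> b = \<kappa> c))
   \<or> (\<exists>L r r'. L \<noteq> {} \<and> L \<subseteq> leaves E \<and> r \<noteq> r' \<and>
        (\<forall>c. c \<notin> L \<longrightarrow> \<kappa> c = r) \<and> (\<forall>c\<in>L. \<kappa> c = r'))
   \<or> (\<exists>J r. J \<noteq> {} \<and> (\<forall>B\<in>J. subtree E B) \<and> Max (depth E ` J) > 1 \<and>
        (\<forall>c. c \<notin> \<Union>J \<longrightarrow> \<kappa> c = r) \<and>
        (\<forall>B\<in>J. \<forall>c\<in>B. \<forall>d\<in>B.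
            (root_dist E B c \<noteq> root_dist E B d \<longrightarrow> \<kappa> c \<noteq> \<kappa> d) \<and>
            (root_dist E B c = root_dist E B d \<longrightarrow> \<kappa> c = \<kappa> d)) \<and>
        (\<forall>B\<in>J. \<forall>B'\<in>J. \<forall>c\<in>B. \<forall>d\<in>B'.
            root_dist E B c = root_dist E B' d \<longrightarrow> \<kappa> c = \<kappa> d))"
proof -
  interpret coloured_network E \<kappa>
    by unfold_locales (rule assms(1), rule assms(6))
  show ?thesis
  proof (cases "\<forall>a b. \<kappa> (\<phi> a) = \<kappa> (\<phi> b) \<longrightarrow> \<kappa> a = \<kappa> b")
    case True
    then show ?thesis
      using periodic_colouring_cases unfolding assms(3) by blast
  next
    case False
    then obtain a b where ab: "\<kappa> a \<noteq> \<kappa> b" "\<kappa> (\<phi> a) = \<kappa> (\<phi> b)"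
      by blast
    obtain p where p: "p \<in> ring E"
      using reaches_ring by blast
    define r where "r = \<kappa> p"
    have ring_r: "\<kappa> c = r" if "c \<in> ring E" for c
      unfolding r_def by (rule ring_monochromatic[OF assms(7) ab that p])
    obtain c where c: "\<kappa> c \<noteq> r"
      using ab(1) by metis
    \<comment> \<open>The chain of inputs of a cell not coloured r enters colour r somewhere; there the pair arises.\<close>
    have "\<exists>e. \<kappa> e \<noteq> r \<and> \<kappa> (\<phi> e) = r"
    proof (rule ccontr)
      assume none: "\<not> ?thesis"
      have "\<kappa> ((\<phi> ^^ l) c) \<noteq> r" for l
        by (induction l) (use c none in auto)
      then show False
        using reaches_ring ring_r by metis
    qed
    then obtain e where e: "\<kappa> e \<noteq> r" "\<kappa> (\<phi> e) = r"
      by blast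
    have pe: "\<kappa> p \<noteq> \<kappa> e" "\<kappa> (\<phi> p) = \<kappa> (\<phi> e)"
      using e ring_r[OF input_in_ring[OF p]] by (auto simp: r_def)
    \<comment> \<open>A second mergeable pair avoiding r would differ from the pair formed by r and the colour of e.\<close>
    interpret levelled_network E \<kappa> r
    proof
      show "\<kappa> c = r" if "c \<in> ring E" for c
        using that by (rule ring_r)
      show "\<kappa> c = \<kappa> d" if "\<kappa> (\<phi> c) = \<kappa> (\<phi> d)" "\<kappa> c \<noteq> r" "\<kappa> d \<noteq> r" for c d
        using mergeable_pair_unique[OF assms(6,7) pe _ that(1)] that(2,3) unfolding r_def
        by (cases "\<kappa> c = \<kappa> d") auto
    qed
    have "\<exists>c. \<kappa> c \<noteq> r"
      using c by blast
    from levelled_colouring_cases[OF this] show ?thesis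
      by (elim disjE) simp_all
  qed
qed

end
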